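(* Let $\varepsilon>0$ and $f\in C^2(\mathbb{R})$, and consider the boundary value problem $$\left(\frac{\varepsilon v_x}{\sqrt{1-\varepsilon^2v_x^2}}\right)_x=f(v)_x,\quad x\in(-\ell,\ell),\qquad v(\pm\ell)=u_\pm,$$ for some $u_+>u_-$. There exists a unique (smooth) increasing solution to this boundary value problem if and only if $$\frac{2\ell}{\varepsilon}>u_+-u_-.$$
   Context: $\ell>0$ is fixed. A smooth solution is a classical solution, regular up to the boundary ($v\in C^2([-\ell,\ell])$), with $\varepsilon|v_x|<1$ so that the operator is defined. *)

theory Defs
  imports "HOL-Analysis.Analysis"
begin

(* On a closed interval the derivatives are one-sided at the end points, so
   C2_on {a..b} g is regularity up to the boundary and C2_on UNIV g is the usual
   notion on the real line. *)
definition C2_on :: "real set \<Rightarrow> (real \<Rightarrow> real) \<Rightarrow> bool" where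
  "C2_on S g \<longleftrightarrow>
     (\<exists>g' g''. (\<forall>x\<in>S. (g has_real_derivative g' x) (at x within S)) \<and>
               (\<forall>x\<in>S. (g' has_real_derivative g'' x) (at x within S)) \<and>
               continuous_on S g'')"

(* v_x on [-l, l], one-sided at the end points. *)
definition slope :: "real \<Rightarrow> (real \<Rightarrow> real) \<Rightarrow> real \<Rightarrow> real" where
  "slope l v x = vector_derivative v (at x within {-l..l})"

definition flux :: "real \<Rightarrow> real \<Rightarrow> real" where
  "flux \<epsilon> p = \<epsilon> * p / sqrt (1 - \<epsilon>\<^sup>2 * p\<^sup>2)"

(* Only the values of v on [-l, l] matter. *)
definition smooth_solution ::
    "real \<Rightarrow> real \<Rightarrow> (real \<Rightarrow> real) \<Rightarrow> real \<Rightarrow> real \<Rightarrow> (real \<Rightarrow> real) \<Rightarrow> bool" where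
  "smooth_solution \<epsilon> l f u_minus u_plus v \<longleftrightarrow>
     C2_on {-l..l} v \<and>
     (\<forall>x\<in>{-l..l}. \<epsilon> * \<bar>slope l v x\<bar> < 1) \<and>
     (\<forall>x\<in>{-l<..<l}. \<exists>D.
        ((\<lambda>y. flux \<epsilon> (slope l v y)) has_real_derivative D) (at x) \<and>
        ((\<lambda>y. f (v y)) has_real_derivative D) (at x)) \<and>
     v (-l) = u_minus \<and> v l = u_plus"

end

theory Submission
  imports Defs
begin

text \<open>
  Integrating the equation once gives \<open>flux \<epsilon> v\<^sub>x = f(v) + c\<close> for a constant \<open>c\<close>. The flux is a
  bijection from \<open>(-1/\<epsilon>, 1/\<epsilon>)\<close> onto the line, so a solution is an orbit of the autonomous
  first-order equation \<open>v\<^sub>x = velocity \<epsilon> (f(v) + c)\<close> joining \<open>u\<^sub>-\<close> to \<open>u\<^sub>+\<close> in time \<open>2l\<close>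
  (\<open>first_integral\<close>, \<open>smooth_solution_of_ode\<close>), with \<open>c\<close> as the only unknown.

  Since \<open>f\<close> is locally Lipschitz, a nonconstant orbit never meets an equilibrium, so
  \<open>f + c > 0\<close> on \<open>[u\<^sub>-, u\<^sub>+]\<close> (\<open>no_equilibrium_on_orbit\<close>). The orbit is then the inverse function
  of the transit time, the integral of \<open>1 / velocity \<epsilon> (f + c)\<close> from \<open>u\<^sub>-\<close>, and the boundary
  value problem reduces to the scalar equation \<open>T(c) = 2l\<close> on \<open>c > - min f\<close>, where
  \<open>T(c)\<close> is the transit time of the whole interval \<open>[u\<^sub>-, u\<^sub>+]\<close>.

  The function \<open>T\<close> is strictly decreasing and continuous. As \<open>c\<close> grows, the velocity tends to
  its supremum \<open>1/\<epsilon>\<close> and \<open>T(c)\<close> tends to \<open>\<epsilon> (u\<^sub>+ - u\<^sub>-)\<close> (\<open>transit_time_upper_bound\<close>). As \<open>c\<close>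
  decreases to \<open>- min f\<close>, the integrand near a minimum point of \<open>f\<close> dominates the reciprocal of
  a linear function, so \<open>T(c)\<close> diverges logarithmically (\<open>transit_time_lower_bound\<close>). Hence
  \<open>T(c) = 2l\<close> has exactly one root when \<open>2l > \<epsilon> (u\<^sub>+ - u\<^sub>-)\<close>. Conversely, the bound
  \<open>\<epsilon> |v\<^sub>x| < 1\<close> and the mean value theorem force this inequality on every solution.
\<close>

section \<open>The velocity as the inverse of the flux\<close>

definition velocity :: "real \<Rightarrow> real \<Rightarrow> real" where
  "velocity \<epsilon> s = s / (\<epsilon> * sqrt (1 + s\<^sup>2))"

lemma sqrt_one_plus_square_pos [simp]: "0 < sqrt (1 + s\<^sup>2)" for s :: real
  by (simp add: add_pos_nonneg)

lemma flux_velocity: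
  assumes "\<epsilon> > 0"
  shows "flux \<epsilon> (velocity \<epsilon> s) = s"
proof -
  have pos: "1 + s\<^sup>2 > 0" by (simp add: add_pos_nonneg)
  have "\<epsilon>\<^sup>2 * (velocity \<epsilon> s)\<^sup>2 = s\<^sup>2 / (1 + s\<^sup>2)"
    using assms pos by (simp add: velocity_def power_divide power_mult_distrib)
  then have "1 - \<epsilon>\<^sup>2 * (velocity \<epsilon> s)\<^sup>2 = 1 / (1 + s\<^sup>2)"
    using pos by (simp add: field_simps)
  then have "sqrt (1 - \<epsilon>\<^sup>2 * (velocity \<epsilon> s)\<^sup>2) = 1 / sqrt (1 + s\<^sup>2)"
    by (simp add: real_sqrt_divide)
  then show ?thesis
    using assms sqrt_one_plus_square_pos[of s] by (simp add: flux_def velocity_def)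
qed

lemma velocity_flux:
  assumes "\<epsilon> > 0" "\<epsilon> * \<bar>p\<bar> < 1"
  shows "velocity \<epsilon> (flux \<epsilon> p) = p"
proof -
  have "(\<epsilon> * \<bar>p\<bar>)\<^sup>2 < 1"
    using assms by (intro power_less_one_iff[THEN iffD2]) auto
  then have pos: "1 - \<epsilon>\<^sup>2 * p\<^sup>2 > 0" by (simp add: power_mult_distrib)
  have "1 + (flux \<epsilon> p)\<^sup>2 = 1 / (1 - \<epsilon>\<^sup>2 * p\<^sup>2)"
    using pos by (simp add: flux_def power_divide power_mult_distrib field_simps)
  then have "sqrt (1 + (flux \<epsilon> p)\<^sup>2) = 1 / sqrt (1 - \<epsilon>\<^sup>2 * p\<^sup>2)"
    by (simp add: real_sqrt_divide)
  then show ?thesis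
    using assms pos by (simp add: velocity_def) (simp add: flux_def)
qed

lemma abs_velocity_less:
  assumes "\<epsilon> > 0"
  shows "\<epsilon> * \<bar>velocity \<epsilon> s\<bar> < 1"
proof -
  have "\<bar>s\<bar> < sqrt (1 + s\<^sup>2)"
    by (rule real_less_rsqrt) auto
  then show ?thesis
    using assms sqrt_one_plus_square_pos[of s]
    by (simp add: velocity_def abs_mult del: sqrt_one_plus_square_pos)
qed

lemma abs_velocity_le:
  assumes "\<epsilon> > 0"
  shows "\<bar>velocity \<epsilon> s\<bar> \<le> \<bar>s\<bar> / \<epsilon>"
proof -
  have "\<bar>s\<bar> / (\<epsilon> * sqrt (1 + s\<^sup>2)) \<le> \<bar>s\<bar> / (\<epsilon> * 1)"
    using assms by (intro divide_left_mono mult_left_mono mult_pos_pos) (auto simp: add_pos_nonneg)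
  then show ?thesis using assms by (simp add: velocity_def abs_mult)
qed

lemma velocity_pos_iff: "\<epsilon> > 0 \<Longrightarrow> velocity \<epsilon> s > 0 \<longleftrightarrow> s > 0"
  unfolding velocity_def by (rule pos_less_divide_eq[THEN trans]) (simp_all add: add_pos_nonneg)

lemma velocity_eq_0_iff: "\<epsilon> > 0 \<Longrightarrow> velocity \<epsilon> s = 0 \<longleftrightarrow> s = 0"
  using sqrt_one_plus_square_pos[of s] by (auto simp: velocity_def)

lemma has_real_derivative_velocity:
  assumes "\<epsilon> > 0"
  shows "(velocity \<epsilon> has_real_derivative 1 / (\<epsilon> * (1 + s\<^sup>2) * sqrt (1 + s\<^sup>2))) (at s)"
proof -
  have pos: "1 + s\<^sup>2 > 0" by (simp add: add_pos_nonneg)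
  define r where "r = sqrt (1 + s\<^sup>2)"
  have r: "r > 0" "1 + s\<^sup>2 = r\<^sup>2" using pos by (auto simp: r_def)
  have "(velocity \<epsilon> has_real_derivative
     (1 * (\<epsilon> * r) - s * (\<epsilon> * (2 * s * (inverse r / 2)))) / ((\<epsilon> * r) * (\<epsilon> * r))) (at s)"
    unfolding velocity_def[abs_def] r_def using assms pos sqrt_one_plus_square_pos[of s]
    by (auto intro!: derivative_eq_intros simp: field_simps)
  moreover have "(1 * (\<epsilon> * r) - s * (\<epsilon> * (2 * s * (inverse r / 2)))) / ((\<epsilon> * r) * (\<epsilon> * r))
      = (r\<^sup>2 - s\<^sup>2) / (\<epsilon> * r\<^sup>2 * r)"
    using assms r by (simp add: field_simps power2_eq_square)
  moreover have "r\<^sup>2 - s\<^sup>2 = 1" using r by simp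
  ultimately show ?thesis using r unfolding r_def by simp
qed

lemma velocity_strict_mono:
  assumes "\<epsilon> > 0" "s < t"
  shows "velocity \<epsilon> s < velocity \<epsilon> t"
proof (rule DERIV_pos_imp_increasing[OF assms(2)])
  fix x :: real
  have "1 + x\<^sup>2 > 0" by (simp add: add_pos_nonneg)
  then show "\<exists>y. (velocity \<epsilon> has_real_derivative y) (at x) \<and> 0 < y"
    using has_real_derivative_velocity[OF assms(1), of x] assms(1)
    by (auto intro!: exI[of _ "1 / (\<epsilon> * (1 + x\<^sup>2) * sqrt (1 + x\<^sup>2))"])
qed

lemma continuous_on_velocity [continuous_intros]:
  assumes "\<epsilon> > 0" "continuous_on S g"
  shows "continuous_on S (\<lambda>x. velocity \<epsilon> (g x))"
proof -
  have "\<epsilon> * sqrt (1 + (g x)\<^sup>2) \<noteq> 0" for x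
    using assms sqrt_one_plus_square_pos[of "g x"] by simp
  then show ?thesis unfolding velocity_def by (intro continuous_intros assms) auto
qed

text \<open>
  Near an equilibrium, where \<open>s\<close> is small, the reciprocal velocity behaves like \<open>\<epsilon>/s\<close>, which makes
  the transit time diverge. For large \<open>s\<close> it approaches \<open>\<epsilon>\<close>, the reciprocal of the limiting
  speed. The next two lemmas are one-sided forms of these facts, valid for all \<open>s > 0\<close>.
\<close>

lemma inverse_velocity_ge:
  assumes "\<epsilon> > 0" "s > 0"
  shows "\<epsilon> / s \<le> 1 / velocity \<epsilon> s"
proof -
  have "\<epsilon> * 1 \<le> \<epsilon> * sqrt (1 + s\<^sup>2)"
    using assms by (intro mult_left_mono) auto
  then show ?thesis using assms by (simp add: velocity_def divide_right_mono)
qed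

lemma inverse_velocity_le:
  assumes "\<epsilon> > 0" "s > 0"
  shows "1 / velocity \<epsilon> s \<le> \<epsilon> * (1 + 1 / s)"
proof -
  have "sqrt (1 + s\<^sup>2) \<le> 1 + s"
    using assms by (intro real_le_lsqrt) (auto simp: power2_eq_square algebra_simps)
  then have "\<epsilon> * sqrt (1 + s\<^sup>2) / s \<le> \<epsilon> * (1 + s) / s"
    using assms by (intro divide_right_mono mult_left_mono) auto
  then show ?thesis using assms by (simp add: velocity_def field_simps)
qed

section \<open>Calculus on a closed interval\<close>

lemma mean_value_within:
  fixes g g' :: "real \<Rightarrow> real"
  assumes "\<And>x. x \<in> {a..b} \<Longrightarrow> (g has_real_derivative g' x) (at x within {a..b})"
    and "a \<le> s" "s < t" "t \<le> b"
  shows "\<exists>z\<in>{s<..<t}. g t - g s = g' z * (t - s)"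
proof (rule mvt_simple[OF \<open>s < t\<close>, where f' = "\<lambda>x. (*) (g' x)"])
  fix x assume "s \<le> x" "x \<le> t"
  then show "(g has_derivative (*) (g' x)) (at x within {s..t})"
    using assms
    by (intro has_field_derivative_imp_has_derivative, intro DERIV_subset[OF assms(1)]) auto
qed

lemma C2_on_Icc_lipschitz:
  assumes "C2_on UNIV f"
  obtains K where "K > 0" "\<And>x y. x \<in> {p..q} \<Longrightarrow> y \<in> {p..q} \<Longrightarrow> \<bar>f x - f y\<bar> \<le> K * \<bar>x - y\<bar>"
proof -
  obtain f' f'' where f': "\<And>x. (f has_real_derivative f' x) (at x)"
    and f'': "\<And>x. (f' has_real_derivative f'' x) (at x)"
    using assms by (auto simp: C2_on_def)
  have "continuous_on {p..q} f'"
    using f'' by (meson DERIV_isCont continuous_at_imp_continuous_on)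
  then have "bounded (f' ` {p..q})"
    by (intro compact_imp_bounded compact_continuous_image) auto
  then obtain K where K: "K > 0" "\<And>x. x \<in> {p..q} \<Longrightarrow> \<bar>f' x\<bar> \<le> K"
    unfolding bounded_pos by auto
  have "norm (f x - f y) \<le> K * norm (x - y)" if "x \<in> {p..q}" "y \<in> {p..q}" for x y
    by (rule field_differentiable_bound[where S = "{p..q}" and f' = f'])
       (use K that f' in \<open>auto intro: has_field_derivative_at_within\<close>)
  with K show ?thesis by (intro that[of K]) auto
qed

lemma C2_on_UNIV_continuous_on: "C2_on UNIV f \<Longrightarrow> continuous_on S f"
  unfolding C2_on_def by (meson DERIV_isCont UNIV_I continuous_at_imp_continuous_on)

text \<open>
  A differential form of Gronwall's inequality: the bound on \<open>y'\<close> makes \<open>y\<^sup>2 exp(-2Mx)\<close>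
  nonincreasing and \<open>y\<^sup>2 exp(2Mx)\<close> nondecreasing. Both are nonnegative and vanish at \<open>x0\<close>, so
  \<open>y\<close> vanishes to the right of \<open>x0\<close> by the first and to the left by the second.
\<close>

lemma zero_of_derivative_bounded_by_value:
  fixes y y' :: "real \<Rightarrow> real"
  assumes der: "\<And>x. x \<in> {a..b} \<Longrightarrow> (y has_real_derivative y' x) (at x within {a..b})"
    and bound: "\<And>x. x \<in> {a..b} \<Longrightarrow> \<bar>y' x\<bar> \<le> M * \<bar>y x\<bar>"
    and x0: "x0 \<in> {a..b}" "y x0 = 0" and x: "x \<in> {a..b}"
  shows "y x = 0"
proof -
  have *: "\<bar>y' z * y z\<bar> \<le> M * (y z * y z)" if "z \<in> {a..b}" for z
    using mult_right_mono[OF bound[OF that], of "\<bar>y z\<bar>"] by (simp add: abs_mult mult.assoc)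
  have E: "((\<lambda>x. (y x)\<^sup>2 * exp (k * x)) has_real_derivative
      (2 * (y' z * y z) + k * (y z * y z)) * exp (k * z)) (at z within {a..b})"
    if "z \<in> {a..b}" for z k
    using der[OF that] by (auto intro!: derivative_eq_intros simp: algebra_simps power2_eq_square)
  consider "x0 < x" | "x = x0" | "x < x0" by linarith
  then show ?thesis
  proof cases
    case 1
    from mean_value_within[OF E[of _ "-2 * M"] _ 1] x x0 obtain z where z: "z \<in> {x0<..<x}"
      "(y x)\<^sup>2 * exp (-2 * M * x) - (y x0)\<^sup>2 * exp (-2 * M * x0) =
        (2 * (y' z * y z) + -2 * M * (y z * y z)) * exp (-2 * M * z) * (x - x0)" by auto
    have "(2 * (y' z * y z) + -2 * M * (y z * y z)) * exp (-2 * M * z) * (x - x0) \<le> 0"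
      using *[of z] z(1) x x0 by (intro mult_nonpos_nonneg) auto
    then have "(y x)\<^sup>2 * exp (-2 * M * x) \<le> 0" using z(2) x0 by simp
    then show ?thesis by (simp add: mult_le_0_iff)
  next
    case 3
    from mean_value_within[OF E[of _ "2 * M"] _ 3] x x0 obtain z where z: "z \<in> {x<..<x0}"
      "(y x0)\<^sup>2 * exp (2 * M * x0) - (y x)\<^sup>2 * exp (2 * M * x) =
        (2 * (y' z * y z) + 2 * M * (y z * y z)) * exp (2 * M * z) * (x0 - x)" by auto
    have "(2 * (y' z * y z) + 2 * M * (y z * y z)) * exp (2 * M * z) * (x0 - x) \<ge> 0"
      using *[of z] z(1) x x0 by (intro mult_nonneg_nonneg) auto
    then have "(y x)\<^sup>2 * exp (2 * M * x) \<le> 0" using z(2) x0 by simp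
    then show ?thesis by (simp add: mult_le_0_iff)
  qed (use x0 in simp)
qed

section \<open>Reduction to a first-order equation\<close>

lemma slope_eq:
  assumes "l > 0" "x \<in> {-l..l}" "(v has_real_derivative d) (at x within {-l..l})"
  shows "slope l v x = d"
  unfolding slope_def using assms
  by (intro vector_derivative_within_closed_interval)
     (auto simp flip: has_real_derivative_iff_has_vector_derivative)

lemma smooth_solution_slope:
  assumes "l > 0" "smooth_solution \<epsilon> l f a b v" "x \<in> {-l..l}"
  shows "(v has_real_derivative slope l v x) (at x within {-l..l})"
proof -
  obtain d where "(v has_real_derivative d) (at x within {-l..l})"
    using assms(2,3) unfolding smooth_solution_def C2_on_def by blast
  then show ?thesis using slope_eq[OF assms(1,3)] by simp
qed

text \<open>The mean slope \<open>(b - a) / (2l)\<close> is attained, and every slope is below \<open>1/\<epsilon>\<close>.\<close>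

lemma gap_less_of_smooth_solution:
  assumes "\<epsilon> > 0" "l > 0" and sol: "smooth_solution \<epsilon> l f a b v"
  shows "b - a < 2 * l / \<epsilon>"
proof -
  from mean_value_within[OF smooth_solution_slope[OF assms(2,3)], of "-l" l] assms(2)
  obtain z where z: "z \<in> {-l<..<l}" "v l - v (-l) = slope l v z * (2 * l)" by auto
  have "\<epsilon> * \<bar>slope l v z\<bar> < 1" using sol z(1) by (auto simp: smooth_solution_def)
  then have "\<epsilon> * slope l v z < 1"
    using assms(1) mult_left_mono[OF abs_ge_self, of \<epsilon> "slope l v z"] by linarith
  then have "\<epsilon> * slope l v z * (2 * l) < 1 * (2 * l)"
    using assms(2) by (intro mult_strict_right_mono) auto
  then have "\<epsilon> * (b - a) < 2 * l"
    using sol z(2) by (simp add: smooth_solution_def mult.assoc)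
  then show ?thesis using assms(1) by (simp add: field_simps)
qed

text \<open>
  The equation holds only on the open interval, but both sides of the integrated equation are
  continuous up to the end points, so the same constant serves on the closed interval.
\<close>

lemma first_integral:
  assumes "\<epsilon> > 0" "l > 0" and f: "C2_on UNIV f" and sol: "smooth_solution \<epsilon> l f a b v"
  obtains c where "\<And>x. x \<in> {-l..l} \<Longrightarrow> slope l v x = velocity \<epsilon> (f (v x) + c)"
proof -
  obtain v' v'' where v': "\<And>x. x \<in> {-l..l} \<Longrightarrow> (v has_real_derivative v' x) (at x within {-l..l})"
    and v'': "\<And>x. x \<in> {-l..l} \<Longrightarrow> (v' has_real_derivative v'' x) (at x within {-l..l})"
    using sol unfolding smooth_solution_def C2_on_def by blast
  have sl: "slope l v x = v' x" if "x \<in> {-l..l}" for x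
    using slope_eq[OF assms(2) that v'[OF that]] .
  have sub: "\<epsilon> * \<bar>slope l v x\<bar> < 1" if "x \<in> {-l..l}" for x
    using sol that by (auto simp: smooth_solution_def)
  have "continuous_on {-l..l} v'" using v'' by (meson DERIV_continuous_on)
  then have cs: "continuous_on {-l..l} (slope l v)" using sl by (metis (no_types, lifting) continuous_on_cong)
  have cv: "continuous_on {-l..l} v" using v' by (meson DERIV_continuous_on)
  define g where "g = (\<lambda>x. flux \<epsilon> (slope l v x) - f (v x))"
  have "1 - \<epsilon>\<^sup>2 * (slope l v x)\<^sup>2 > 0" if "x \<in> {-l..l}" for x
  proof -
    have "(\<epsilon> * \<bar>slope l v x\<bar>)\<^sup>2 < 1"
      using assms(1) sub[OF that] by (intro power_less_one_iff[THEN iffD2]) auto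
    then show ?thesis by (simp add: power_mult_distrib)
  qed
  then have "\<forall>x\<in>{-l..l}. sqrt (1 - \<epsilon>\<^sup>2 * (slope l v x)\<^sup>2) \<noteq> 0" by fastforce
  then have "continuous_on {-l..l} (\<lambda>x. flux \<epsilon> (slope l v x))"
    unfolding flux_def by (intro continuous_intros cs)
  moreover have "continuous_on {-l..l} (\<lambda>x. f (v x))"
    by (rule continuous_on_compose2[OF C2_on_UNIV_continuous_on[OF f, of UNIV] cv]) simp
  ultimately have "continuous_on {-l..l} g" unfolding g_def by (rule continuous_on_diff)
  moreover have "(g has_real_derivative 0) (at x)" if "-l < x" "x < l" for x
  proof -
    obtain D where "((\<lambda>y. flux \<epsilon> (slope l v y)) has_real_derivative D) (at x)"
        "((\<lambda>y. f (v y)) has_real_derivative D) (at x)"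
      using sol greaterThanLessThan_iff[THEN iffD2, OF conjI, OF \<open>-l < x\<close> \<open>x < l\<close>]
      unfolding smooth_solution_def by blast
    from DERIV_diff[OF this] show ?thesis by (simp add: g_def)
  qed
  ultimately have const: "g x = g (-l)" if "x \<in> {-l..l}" for x
    using DERIV_isconst2[of "-l" l g x] that assms(2) by auto
  show ?thesis
  proof (rule that[of "g (-l)"])
    fix x assume x: "x \<in> {-l..l}"
    have "f (v x) + g (-l) = flux \<epsilon> (slope l v x)"
      using const[OF x] by (simp add: g_def)
    then show "slope l v x = velocity \<epsilon> (f (v x) + g (-l))"
      using velocity_flux[OF assms(1) sub[OF x]] by simp
  qed
qed

text \<open>
  If \<open>f(v) + c\<close> vanished at a point \<open>x0\<close>, then \<open>v(x0)\<close> would be an equilibrium and, by the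
  Lipschitz bound for \<open>f\<close> on the range of \<open>v\<close>, the difference \<open>v - v(x0)\<close> would satisfy the
  Gronwall inequality and vanish identically, against \<open>v(-l) < v(l)\<close>. So \<open>f(v) + c\<close> has no
  zero, hence constant sign, and the sign is positive because \<open>v\<close> increases on average.
\<close>

lemma no_equilibrium_on_orbit:
  assumes "\<epsilon> > 0" and f: "C2_on UNIV f"
    and ode: "\<And>x. x \<in> {-l..l} \<Longrightarrow>
      (v has_real_derivative velocity \<epsilon> (f (v x) + c)) (at x within {-l..l})"
    and "l > 0" "v (-l) < v l" and x: "x \<in> {-l..l}"
  shows "f (v x) + c > 0"
proof -
  have cv: "continuous_on {-l..l} v" using ode by (meson DERIV_continuous_on)
  have "bounded (v ` {-l..l})"
    using cv by (intro compact_imp_bounded compact_continuous_image) auto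
  then obtain B where B: "\<And>x. x \<in> {-l..l} \<Longrightarrow> \<bar>v x\<bar> \<le> B"
    unfolding bounded_pos real_norm_def by blast
  obtain K where K: "K > 0"
    "\<And>x y. x \<in> {-B..B} \<Longrightarrow> y \<in> {-B..B} \<Longrightarrow> \<bar>f x - f y\<bar> \<le> K * \<bar>x - y\<bar>"
    using C2_on_Icc_lipschitz[OF f] by blast
  have nz: "f (v x0) + c \<noteq> 0" if x0: "x0 \<in> {-l..l}" for x0
  proof
    assume eq: "f (v x0) + c = 0"
    have "v z - v x0 = 0" if z: "z \<in> {-l..l}" for z
    proof (rule zero_of_derivative_bounded_by_value[where M = "K / \<epsilon>"
            and y' = "\<lambda>x. velocity \<epsilon> (f (v x) + c)", OF _ _ x0 _ z])
      fix x assume x: "x \<in> {-l..l}"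
      show "((\<lambda>x. v x - v x0) has_real_derivative velocity \<epsilon> (f (v x) + c)) (at x within {-l..l})"
        using ode[OF x] by (auto intro!: derivative_eq_intros)
      have "\<bar>velocity \<epsilon> (f (v x) + c)\<bar> \<le> \<bar>f (v x) - f (v x0)\<bar> / \<epsilon>"
        using abs_velocity_le[OF assms(1), of "f (v x) + c"] eq
        by (simp add: eq_neg_iff_add_eq_0[symmetric])
      also have "\<dots> \<le> (K * \<bar>v x - v x0\<bar>) / \<epsilon>"
        using B[OF x] B[OF x0] assms(1) by (intro divide_right_mono K) auto
      finally show "\<bar>velocity \<epsilon> (f (v x) + c)\<bar> \<le> K / \<epsilon> * \<bar>v x - v x0\<bar>" by simp
    qed simp
    from this[of l] this[of "-l"] assms(4,5) show False by auto
  qed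
  from mean_value_within[OF ode, of "-l" l] assms(4)
  obtain z where z: "z \<in> {-l<..<l}" "v l - v (-l) = velocity \<epsilon> (f (v z) + c) * (2 * l)" by auto
  then have "velocity \<epsilon> (f (v z) + c) > 0"
    using assms(4,5) by (metis diff_gt_0_iff_gt zero_less_mult_pos2 mult_2 add_pos_pos)
  then have zpos: "f (v z) + c > 0" using velocity_pos_iff[OF assms(1)] by blast
  have "continuous_on {-l..l} (\<lambda>x. f (v x) + c)"
    by (intro continuous_intros continuous_on_compose2[OF C2_on_UNIV_continuous_on[OF f, of UNIV] cv])
       simp
  then have "connected ((\<lambda>x. f (v x) + c) ` {-l..l})"
    by (rule connected_continuous_image) simp
  moreover have "f (v z) + c \<in> (\<lambda>x. f (v x) + c) ` {-l..l}" using z(1) by auto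
  moreover have "0 \<notin> (\<lambda>x. f (v x) + c) ` {-l..l}" using nz by fastforce
  moreover have "f (v x) + c \<in> (\<lambda>x. f (v x) + c) ` {-l..l}" using x by blast
  ultimately show ?thesis
    using zpos unfolding connected_iff_interval by (meson not_less less_imp_le)
qed

section \<open>The transit time and uniqueness\<close>

text \<open>
  The time an orbit of the equation with constant \<open>c\<close> takes from the level \<open>a\<close> to the level \<open>u\<close>.
\<close>

definition transit_time :: "real \<Rightarrow> (real \<Rightarrow> real) \<Rightarrow> real \<Rightarrow> real \<Rightarrow> real \<Rightarrow> real" where
  "transit_time \<epsilon> f a c u = integral {a..u} (\<lambda>w. 1 / velocity \<epsilon> (f w + c))"

lemma continuous_on_inverse_velocity:
  assumes "\<epsilon> > 0" "C2_on UNIV f" "\<And>u. u \<in> {a..b} \<Longrightarrow> f u + c > 0"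
  shows "continuous_on {a..b} (\<lambda>w. 1 / velocity \<epsilon> (f w + c))"
  by (intro continuous_intros assms C2_on_UNIV_continuous_on ballI)
     (use assms velocity_eq_0_iff in force)

lemma transit_time_has_derivative:
  assumes "\<epsilon> > 0" "C2_on UNIV f" "\<And>u. u \<in> {a..b} \<Longrightarrow> f u + c > 0" "u \<in> {a..b}"
  shows "(transit_time \<epsilon> f a c has_real_derivative 1 / velocity \<epsilon> (f u + c)) (at u within {a..b})"
  unfolding transit_time_def[abs_def]
  by (rule integral_has_real_derivative[OF continuous_on_inverse_velocity[OF assms(1,2,3)] assms(4)])

lemma transit_time_strict_mono:
  assumes "\<epsilon> > 0" "C2_on UNIV f" "\<And>u. u \<in> {a..b} \<Longrightarrow> f u + c > 0"
  shows "strict_mono_on {a..b} (transit_time \<epsilon> f a c)"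
proof (rule strict_mono_onI)
  fix s t assume st: "s \<in> {a..b}" "t \<in> {a..b}" "s < t"
  have "a \<le> s" "t \<le> b" using st by auto
  then obtain z where z: "z \<in> {s<..<t}"
    "transit_time \<epsilon> f a c t - transit_time \<epsilon> f a c s = 1 / velocity \<epsilon> (f z + c) * (t - s)"
    using mean_value_within[OF transit_time_has_derivative[OF assms(1,2)], of a b c s t]
      assms(3) st(3) by blast
  have "1 / velocity \<epsilon> (f z + c) > 0"
    using assms z(1) st by (simp add: velocity_pos_iff)
  then show "transit_time \<epsilon> f a c s < transit_time \<epsilon> f a c t"
    using z(2) st by (smt (verit) mult_pos_pos)
qed

text \<open>Separation of variables: \<open>x \<mapsto> transit_time (v x)\<close> has derivative 1.\<close>

lemma transit_time_along_orbit:
  assumes "\<epsilon> > 0" and f: "C2_on UNIV f" and pos: "\<And>u. u \<in> {a..b} \<Longrightarrow> f u + c > 0"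
    and ode: "\<And>x. x \<in> {-l..l} \<Longrightarrow>
      (v has_real_derivative velocity \<epsilon> (f (v x) + c)) (at x within {-l..l})"
    and range: "v ` {-l..l} \<subseteq> {a..b}" and "v (-l) = a" and x: "x \<in> {-l..l}"
  shows "transit_time \<epsilon> f a c (v x) = x + l"
proof (cases "x = -l")
  case True then show ?thesis using assms by (simp add: transit_time_def)
next
  case False
  have "((\<lambda>x. transit_time \<epsilon> f a c (v x)) has_real_derivative 1) (at z within {-l..l})"
    if z: "z \<in> {-l..l}" for z
  proof -
    have vz: "v z \<in> {a..b}" using range z by blast
    have "(transit_time \<epsilon> f a c has_real_derivative 1 / velocity \<epsilon> (f (v z) + c))
        (at (v z) within v ` {-l..l})"
      using transit_time_has_derivative[OF assms(1) f pos vz] range by (rule DERIV_subset)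
    from DERIV_image_chain[OF this ode[OF z]]
    show ?thesis using velocity_eq_0_iff[OF assms(1)] pos[OF vz] by (simp add: o_def)
  qed
  from mean_value_within[OF this, of "-l" x] False x
  show ?thesis using assms(6) by (auto simp: transit_time_def)
qed

text \<open>
  All that uniqueness needs of a solution: its constant \<open>c\<close> is admissible on the whole of
  \<open>[a, b]\<close>, because \<open>v\<close> takes every value there, and the transit time inverts \<open>v\<close>.
\<close>

lemma smooth_solution_transit:
  assumes "\<epsilon> > 0" "l > 0" and f: "C2_on UNIV f" and "a < b"
    and sol: "smooth_solution \<epsilon> l f a b v"
  obtains c where "\<And>u. u \<in> {a..b} \<Longrightarrow> f u + c > 0"
    and "\<And>x. x \<in> {-l..l} \<Longrightarrow> v x \<in> {a..b} \<and> transit_time \<epsilon> f a c (v x) = x + l"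
proof -
  obtain c where c: "\<And>x. x \<in> {-l..l} \<Longrightarrow> slope l v x = velocity \<epsilon> (f (v x) + c)"
    using first_integral[OF assms(1-3) sol] by blast
  then have ode: "(v has_real_derivative velocity \<epsilon> (f (v x) + c)) (at x within {-l..l})"
    if "x \<in> {-l..l}" for x
    using smooth_solution_slope[OF assms(2) sol that] that by simp
  have ends: "v (-l) = a" "v l = b" using sol by (auto simp: smooth_solution_def)
  have pos: "f (v x) + c > 0" if "x \<in> {-l..l}" for x
    using no_equilibrium_on_orbit[OF assms(1) f ode assms(2) _ that] ends assms(4) by simp
  have cv: "continuous_on {-l..l} v" using ode by (meson DERIV_continuous_on)
  have mono: "v s \<le> v t" if "-l \<le> s" "s \<le> t" "t \<le> l" for s t
  proof (cases "s = t")
    case False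
    with that obtain z where z: "z \<in> {s<..<t}"
      "v t - v s = velocity \<epsilon> (f (v z) + c) * (t - s)"
      using mean_value_within[OF ode, of s t] by auto
    have "velocity \<epsilon> (f (v z) + c) > 0"
      using pos[of z] z(1) that assms(1) by (simp add: velocity_pos_iff)
    with z(2) that show ?thesis by (smt (verit) mult_nonneg_nonneg)
  qed simp
  have range: "v ` {-l..l} \<subseteq> {a..b}" using mono ends assms(2) by fastforce
  have posab: "f u + c > 0" if "u \<in> {a..b}" for u
  proof -
    have "\<exists>x\<ge>-l. x \<le> l \<and> v x = u"
      by (rule IVT') (use that ends cv assms(2) in auto)
    then show ?thesis using pos by auto
  qed
  show ?thesis
  proof (rule that[OF posab])
    fix x assume "x \<in> {-l..l}"
    then show "v x \<in> {a..b} \<and> transit_time \<epsilon> f a c (v x) = x + l"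
      using transit_time_along_orbit[OF assms(1) f posab ode range ends(1)] range by blast
  qed
qed

lemma transit_time_strict_antimono:
  assumes "\<epsilon> > 0" "C2_on UNIV f" "a < b" "\<And>u. u \<in> {a..b} \<Longrightarrow> f u + c > 0" "c < d"
  shows "transit_time \<epsilon> f a d b < transit_time \<epsilon> f a c b"
proof -
  have pd: "f u + d > 0" if "u \<in> {a..b}" for u using assms(4)[OF that] assms(5) by simp
  show ?thesis unfolding transit_time_def
  proof (rule integral_less_real)
    fix x assume "x \<in> {a<..<b}"
    then have "f x + c > 0" using assms(4) by simp
    then show "1 / velocity \<epsilon> (f x + d) < 1 / velocity \<epsilon> (f x + c)"
      using assms(1,5) by (intro divide_strict_left_mono velocity_strict_mono mult_pos_pos)
        (auto simp: velocity_pos_iff)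
  qed (use assms pd in \<open>auto intro!: continuous_on_inverse_velocity\<close>)
qed

text \<open>
  Two solutions cross \<open>[a, b]\<close> in the same time \<open>2l\<close>, which forces their constants to agree.
  They are then inverses of the same injective transit time.
\<close>

lemma smooth_solution_unique:
  assumes "\<epsilon> > 0" "l > 0" "C2_on UNIV f" "a < b"
    and v: "smooth_solution \<epsilon> l f a b v" and w: "smooth_solution \<epsilon> l f a b w"
    and x: "x \<in> {-l..l}"
  shows "w x = v x"
proof -
  obtain c where c: "\<And>u. u \<in> {a..b} \<Longrightarrow> f u + c > 0"
    "\<And>x. x \<in> {-l..l} \<Longrightarrow> v x \<in> {a..b} \<and> transit_time \<epsilon> f a c (v x) = x + l"
    using smooth_solution_transit[OF assms(1-4) v] by blast
  obtain d where d: "\<And>u. u \<in> {a..b} \<Longrightarrow> f u + d > 0"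
    "\<And>x. x \<in> {-l..l} \<Longrightarrow> w x \<in> {a..b} \<and> transit_time \<epsilon> f a d (w x) = x + l"
    using smooth_solution_transit[OF assms(1-4) w] by blast
  have "v l = b" "w l = b" using v w by (auto simp: smooth_solution_def)
  then have "transit_time \<epsilon> f a c b = transit_time \<epsilon> f a d b"
    using c(2)[of l] d(2)[of l] assms(2) by simp
  then have "c = d"
    using transit_time_strict_antimono[OF assms(1,3,4) c(1), of d]
      transit_time_strict_antimono[OF assms(1,3,4) d(1), of c] by (cases c d rule: linorder_cases) auto
  moreover have "inj_on (transit_time \<epsilon> f a c) {a..b}"
    using transit_time_strict_mono[OF assms(1,3) c(1)] by (simp add: strict_mono_on_imp_inj_on)
  ultimately show ?thesis using c(2)[OF x] d(2)[OF x]
    unfolding inj_on_def by metis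
qed

section \<open>The range of the total transit time\<close>

lemma transit_time_continuous_in_constant:
  assumes "\<epsilon> > 0" "C2_on UNIV f" "\<And>u. u \<in> {a..b} \<Longrightarrow> m \<le> f u"
  shows "continuous_on {-m<..} (\<lambda>c. transit_time \<epsilon> f a c b)"
proof -
  have pos: "f u + c > 0" if "u \<in> {a..b}" "c \<in> {-m<..}" for u c
    using assms(3)[OF that(1)] that(2) by simp
  have "continuous_on ({-m<..} \<times> cbox a b) (\<lambda>(c, w). 1 / velocity \<epsilon> (f w + c))"
    unfolding split_def
    by (intro continuous_intros assms ballI continuous_on_compose2[OF C2_on_UNIV_continuous_on[OF assms(2), of UNIV]])
       (use pos velocity_eq_0_iff[OF assms(1)] in force)+
  from integral_continuous_on_param[OF this] show ?thesis by (simp add: transit_time_def)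
qed

lemma transit_time_upper_bound:
  assumes "\<epsilon> > 0" "C2_on UNIV f" "a < b" "\<And>u. u \<in> {a..b} \<Longrightarrow> m \<le> f u" "-m < c"
  shows "transit_time \<epsilon> f a c b \<le> \<epsilon> * (1 + 1 / (m + c)) * (b - a)"
proof -
  have pos: "f u + c > 0" if "u \<in> {a..b}" for u
    using assms(4)[OF that] assms(5) by simp
  obtain z where z: "z \<in> {a<..<b}"
    "transit_time \<epsilon> f a c b - transit_time \<epsilon> f a c a = 1 / velocity \<epsilon> (f z + c) * (b - a)"
    using mean_value_within[OF transit_time_has_derivative[OF assms(1,2)], of a b c a b] pos assms(3)
    by blast
  have "1 / velocity \<epsilon> (f z + c) \<le> \<epsilon> * (1 + 1 / (f z + c))"
    using inverse_velocity_le[OF assms(1) pos] z(1) by simp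
  also have "\<dots> \<le> \<epsilon> * (1 + 1 / (m + c))"
    using assms(1,5) assms(4)[of z] z(1) by (intro mult_left_mono add_left_mono divide_left_mono) auto
  finally have "1 / velocity \<epsilon> (f z + c) * (b - a) \<le> \<epsilon> * (1 + 1 / (m + c)) * (b - a)"
    using assms(3) by (intro mult_right_mono) auto
  with z(2) show ?thesis by (simp add: transit_time_def)
qed

text \<open>
  The bound on \<open>f\<close> makes the integrand at least \<open>\<epsilon> / (K |u - u0| + \<delta>)\<close>. Integrating this on both
  sides of the minimum point \<open>u0\<close> gives two logarithms, one of which may be trivial if \<open>u0\<close> is an
  end point. Writing \<open>p = K (b - u0)\<close> and \<open>q = K (u0 - a)\<close>, the inequality
  \<open>(p + \<delta>) (q + \<delta>) \<ge> (p + q) \<delta>\<close> merges them into a bound that does not depend on where \<open>u0\<close>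
  lies. It tends to infinity as \<open>\<delta>\<close> tends to 0.
\<close>

lemma transit_time_lower_bound:
  assumes "\<epsilon> > 0" "C2_on UNIV f" "a < b" "K > 0" "\<delta> > 0" "u0 \<in> {a..b}"
    and above: "\<And>u. u \<in> {a..b} \<Longrightarrow> f u0 \<le> f u"
    and linear: "\<And>u. u \<in> {a..b} \<Longrightarrow> f u \<le> f u0 + K * \<bar>u - u0\<bar>"
  shows "\<epsilon> / K * ln (K * (b - a) / \<delta>) \<le> transit_time \<epsilon> f a (\<delta> - f u0) b"
proof -
  define c where "c = \<delta> - f u0"
  have pos: "f u + c > 0" if "u \<in> {a..b}" for u
    using above[OF that] assms(5) by (simp add: c_def)
  define G where "G = transit_time \<epsilon> f a c"
  have G: "(G has_real_derivative 1 / velocity \<epsilon> (f u + c)) (at u within {a..b})"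
    if "u \<in> {a..b}" for u
    unfolding G_def by (rule transit_time_has_derivative[OF assms(1,2) pos that])
  have ge: "\<epsilon> / (K * \<bar>u - u0\<bar> + \<delta>) \<le> 1 / velocity \<epsilon> (f u + c)" if "u \<in> {a..b}" for u
  proof -
    have "\<epsilon> / (K * \<bar>u - u0\<bar> + \<delta>) \<le> \<epsilon> / (f u + c)"
      using linear[OF that] pos[OF that] assms(1,4,5)
      by (intro divide_left_mono) (auto simp: c_def intro!: mult_pos_pos add_nonneg_pos)
    also have "\<dots> \<le> 1 / velocity \<epsilon> (f u + c)"
      by (rule inverse_velocity_ge[OF assms(1) pos[OF that]])
    finally show ?thesis .
  qed
  have right: "\<epsilon> / K * ln (K * (b - u0) + \<delta>) - \<epsilon> / K * ln \<delta> \<le> G b - G u0"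
  proof (cases "u0 = b")
    case False
    have D: "((\<lambda>u. G u - \<epsilon> / K * ln (K * (u - u0) + \<delta>)) has_real_derivative
        1 / velocity \<epsilon> (f u + c) - \<epsilon> / (K * (u - u0) + \<delta>)) (at u within {u0..b})"
      if "u \<in> {u0..b}" for u
    proof -
      have "K * (u - u0) + \<delta> > 0" using that assms(4,5) by (intro add_nonneg_pos) auto
      then have "((\<lambda>u. \<epsilon> / K * ln (K * (u - u0) + \<delta>)) has_real_derivative \<epsilon> / (K * (u - u0) + \<delta>))
          (at u within {u0..b})"
        using assms(4) by (auto intro!: derivative_eq_intros simp: divide_simps)
      moreover have "(G has_real_derivative 1 / velocity \<epsilon> (f u + c)) (at u within {u0..b})"
        by (rule DERIV_subset[OF G]) (use that assms(6) in auto)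
      ultimately show ?thesis using DERIV_diff by fastforce
    qed
    obtain z where z: "z \<in> {u0<..<b}"
      "(G b - \<epsilon> / K * ln (K * (b - u0) + \<delta>)) - (G u0 - \<epsilon> / K * ln (K * (u0 - u0) + \<delta>)) =
       (1 / velocity \<epsilon> (f z + c) - \<epsilon> / (K * (z - u0) + \<delta>)) * (b - u0)"
      using mean_value_within[OF D order_refl _ order_refl] False assms(6)
      by (metis atLeastAtMost_iff order_less_le)
    have "(1 / velocity \<epsilon> (f z + c) - \<epsilon> / (K * (z - u0) + \<delta>)) * (b - u0) \<ge> 0"
      using ge[of z] z(1) assms(6) by (intro mult_nonneg_nonneg) auto
    with z(2) show ?thesis by simp
  qed simp
  have left: "\<epsilon> / K * ln (K * (u0 - a) + \<delta>) - \<epsilon> / K * ln \<delta> \<le> G u0 - G a"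
  proof (cases "u0 = a")
    case False
    have D: "((\<lambda>u. G u + \<epsilon> / K * ln (K * (u0 - u) + \<delta>)) has_real_derivative
        1 / velocity \<epsilon> (f u + c) - \<epsilon> / (K * (u0 - u) + \<delta>)) (at u within {a..u0})"
      if "u \<in> {a..u0}" for u
    proof -
      have "K * (u0 - u) + \<delta> > 0" using that assms(4,5) by (intro add_nonneg_pos) auto
      then have "((\<lambda>u. \<epsilon> / K * ln (K * (u0 - u) + \<delta>)) has_real_derivative - (\<epsilon> / (K * (u0 - u) + \<delta>)))
          (at u within {a..u0})"
        using assms(4) by (auto intro!: derivative_eq_intros simp: divide_simps)
      moreover have "(G has_real_derivative 1 / velocity \<epsilon> (f u + c)) (at u within {a..u0})"
        by (rule DERIV_subset[OF G]) (use that assms(6) in auto)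
      ultimately show ?thesis using DERIV_add by fastforce
    qed
    obtain z where z: "z \<in> {a<..<u0}"
      "(G u0 + \<epsilon> / K * ln (K * (u0 - u0) + \<delta>)) - (G a + \<epsilon> / K * ln (K * (u0 - a) + \<delta>)) =
       (1 / velocity \<epsilon> (f z + c) - \<epsilon> / (K * (u0 - z) + \<delta>)) * (u0 - a)"
      using mean_value_within[OF D order_refl _ order_refl] False assms(6)
      by (metis atLeastAtMost_iff order_less_le)
    have "(1 / velocity \<epsilon> (f z + c) - \<epsilon> / (K * (u0 - z) + \<delta>)) * (u0 - a) \<ge> 0"
      using ge[of z] z(1) assms(6) by (intro mult_nonneg_nonneg) auto
    with z(2) show ?thesis by simp
  qed simp
  define p q where "p = K * (b - u0)" and "q = K * (u0 - a)"
  have pq: "p \<ge> 0" "q \<ge> 0" "p + q = K * (b - a)"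
    using assms(4,6) by (auto simp: p_def q_def algebra_simps)
  have "p + q > 0" using pq(3) assms(3,4) by simp
  then have "ln ((p + q) / \<delta>) = ln ((p + q) * \<delta>) - 2 * ln \<delta>"
    using assms(5) by (simp add: ln_div ln_mult)
  also have "ln ((p + q) * \<delta>) \<le> ln ((p + \<delta>) * (q + \<delta>))"
    using mult_pos_pos[OF \<open>p + q > 0\<close> assms(5)] pq(1,2) by (intro ln_mono) (auto simp: algebra_simps)
  also have "\<dots> = ln (p + \<delta>) + ln (q + \<delta>)"
    using pq(1,2) assms(5) by (intro ln_mult_pos) auto
  finally have "ln ((p + q) / \<delta>) \<le> (ln (p + \<delta>) - ln \<delta>) + (ln (q + \<delta>) - ln \<delta>)" by simp
  then have "\<epsilon> / K * ln ((p + q) / \<delta>) \<le> \<epsilon> / K * ((ln (p + \<delta>) - ln \<delta>) + (ln (q + \<delta>) - ln \<delta>))"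
    using assms(1,4) by (intro mult_left_mono) auto
  also have "\<dots> \<le> G b - G a"
    using left right by (simp only: p_def q_def distrib_left right_diff_distrib)
  finally show ?thesis using pq(3) by (simp add: G_def c_def transit_time_def)
qed

text \<open>Intermediate values, between two constants for which the bounds above become \<open>T\<close> exactly.\<close>

lemma exists_constant_with_transit_time:
  assumes "\<epsilon> > 0" and f: "C2_on UNIV f" and "a < b" and T: "\<epsilon> * (b - a) < T"
  obtains c where "\<And>u. u \<in> {a..b} \<Longrightarrow> f u + c > 0" "transit_time \<epsilon> f a c b = T"
proof -
  obtain u0 where u0: "u0 \<in> {a..b}" "\<And>u. u \<in> {a..b} \<Longrightarrow> f u0 \<le> f u"
    using continuous_attains_inf[of "{a..b}" f] C2_on_UNIV_continuous_on[OF f] assms(3) by auto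
  define m where "m = f u0"
  obtain K where K: "K > 0"
    "\<And>x y. x \<in> {a..b} \<Longrightarrow> y \<in> {a..b} \<Longrightarrow> \<bar>f x - f y\<bar> \<le> K * \<bar>x - y\<bar>"
    using C2_on_Icc_lipschitz[OF f] by blast
  \<comment> \<open>\<delta> solves \<open>\<epsilon> / K * ln (K (b - a) / \<delta>) = T\<close>, and \<eta> solves \<open>\<epsilon> (1 + \<eta>) (b - a) = T\<close>.\<close>
  define \<delta> where "\<delta> = K * (b - a) * exp (- (K * T / \<epsilon>))"
  define \<eta> where "\<eta> = T / (\<epsilon> * (b - a)) - 1"
  have \<delta>: "\<delta> > 0" using K assms(3) by (simp add: \<delta>_def)
  have \<eta>: "\<eta> > 0" using assms by (simp add: \<eta>_def field_simps)
  have "\<epsilon> / K * ln (K * (b - a) / \<delta>) \<le> transit_time \<epsilon> f a (\<delta> - m) b"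
    unfolding m_def
  proof (rule transit_time_lower_bound[OF assms(1) f assms(3) K(1) \<delta> u0])
    fix u assume "u \<in> {a..b}"
    then show "f u \<le> f u0 + K * \<bar>u - u0\<bar>" using K(2)[of u u0] u0(1) by auto
  qed
  moreover have "K * (b - a) / \<delta> = exp (K * T / \<epsilon>)"
    using K assms(3) by (simp add: \<delta>_def exp_minus field_simps)
  ultimately have lower: "T \<le> transit_time \<epsilon> f a (\<delta> - m) b"
    using K(1) assms(1) by simp
  have "transit_time \<epsilon> f a (1 / \<eta> - m) b \<le> \<epsilon> * (1 + \<eta>) * (b - a)"
    using transit_time_upper_bound[OF assms(1) f assms(3), of m "1 / \<eta> - m"] u0(2) \<eta>
    by (simp add: m_def)
  also have "\<dots> = T" using assms(1,3) by (simp add: \<eta>_def)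
  finally have upper: "transit_time \<epsilon> f a (1 / \<eta> - m) b \<le> T" .
  have "continuous_on {-m<..} (\<lambda>c. transit_time \<epsilon> f a c b)"
    by (rule transit_time_continuous_in_constant[OF assms(1) f]) (simp add: m_def u0)
  then have "connected ((\<lambda>c. transit_time \<epsilon> f a c b) ` {-m<..})"
    by (rule connected_continuous_image) simp
  moreover have "transit_time \<epsilon> f a (\<delta> - m) b \<in> (\<lambda>c. transit_time \<epsilon> f a c b) ` {-m<..}"
    "transit_time \<epsilon> f a (1 / \<eta> - m) b \<in> (\<lambda>c. transit_time \<epsilon> f a c b) ` {-m<..}"
    using \<delta> \<eta> by auto
  ultimately have "T \<in> (\<lambda>c. transit_time \<epsilon> f a c b) ` {-m<..}"
    using lower upper unfolding connected_iff_interval by blast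
  then obtain c where "c > -m" "transit_time \<epsilon> f a c b = T" by auto
  then show ?thesis using u0(2) by (intro that[of c]) (force simp: m_def)+
qed

section \<open>Construction of the solution\<close>

text \<open>
  The right-hand side of the first-order equation is differentiable along \<open>v\<close>, which gives \<open>v\<close> its
  second derivative; applying the flux to the equation returns \<open>f(v) + c\<close>, whose derivative
  is that of \<open>f(v)\<close>.
\<close>

lemma smooth_solution_of_ode:
  assumes "\<epsilon> > 0" "l > 0" and f: "C2_on UNIV f"
    and ode: "\<And>x. x \<in> {-l..l} \<Longrightarrow>
      (v has_real_derivative velocity \<epsilon> (f (v x) + c)) (at x within {-l..l})"
  shows "smooth_solution \<epsilon> l f (v (-l)) (v l) v"
proof -
  obtain f' f'' where f': "\<And>x. (f has_real_derivative f' x) (at x)"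
    and f'': "\<And>x. (f' has_real_derivative f'' x) (at x)"
    using f by (auto simp: C2_on_def)
  have cv: "continuous_on {-l..l} v" using ode by (meson DERIV_continuous_on)
  have cf': "continuous_on {-l..l} (\<lambda>x. f' (v x))"
    by (rule continuous_on_compose2[OF _ cv, of UNIV])
       (use f'' in \<open>auto intro: DERIV_isCont continuous_at_imp_continuous_on\<close>)
  have cf: "continuous_on {-l..l} (\<lambda>x. f (v x))"
    by (rule continuous_on_compose2[OF C2_on_UNIV_continuous_on[OF f, of UNIV] cv]) simp
  define s where "s = (\<lambda>x. f (v x) + c)"
  define v'' where
    "v'' = (\<lambda>x. 1 / (\<epsilon> * (1 + (s x)\<^sup>2) * sqrt (1 + (s x)\<^sup>2)) * (f' (v x) * velocity \<epsilon> (s x)))"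
  have fv: "((\<lambda>x. f (v x)) has_real_derivative f' (v x) * velocity \<epsilon> (s x)) (at x within {-l..l})"
    if "x \<in> {-l..l}" for x
    using DERIV_chain2[OF f' ode[OF that]] by (simp add: s_def)
  have "((\<lambda>x. velocity \<epsilon> (s x)) has_real_derivative v'' x) (at x within {-l..l})"
    if "x \<in> {-l..l}" for x
    unfolding v''_def
    by (rule DERIV_chain2[OF has_real_derivative_velocity[OF assms(1)]])
       (use fv[OF that] in \<open>auto simp: s_def intro!: derivative_eq_intros\<close>)
  moreover have "continuous_on {-l..l} v''"
  proof -
    have "1 + (s x)\<^sup>2 \<noteq> 0" for x using zero_le_power2[of "s x"] by linarith
    then show ?thesis
      unfolding v''_def s_def using assms(1)
      by (intro continuous_intros cf cf') auto
  qed
  ultimately have "C2_on {-l..l} v"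
    unfolding C2_on_def using ode by (intro exI[of _ "\<lambda>x. velocity \<epsilon> (s x)"] exI[of _ v'']) (auto simp: s_def)
  moreover have sl: "slope l v x = velocity \<epsilon> (s x)" if "x \<in> {-l..l}" for x
    using slope_eq[OF assms(2) that ode[OF that]] by (simp add: s_def)
  moreover have "\<exists>D. ((\<lambda>y. flux \<epsilon> (slope l v y)) has_real_derivative D) (at x) \<and>
        ((\<lambda>y. f (v y)) has_real_derivative D) (at x)" if x: "x \<in> {-l<..<l}" for x
  proof -
    have at: "((\<lambda>y. f (v y)) has_real_derivative f' (v x) * velocity \<epsilon> (s x)) (at x)"
      using fv[of x] x by (simp add: at_within_Icc_at)
    have "((\<lambda>y. f (v y) + c) has_real_derivative f' (v x) * velocity \<epsilon> (s x)) (at x)"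
      using at by (auto intro!: derivative_eq_intros)
    then have "((\<lambda>y. flux \<epsilon> (slope l v y)) has_real_derivative f' (v x) * velocity \<epsilon> (s x)) (at x)"
      by (rule has_field_derivative_transform_within_open[of _ _ _ "{-l<..<l}"])
         (use x in \<open>auto simp: sl s_def flux_velocity[OF assms(1)]\<close>)
    with at show ?thesis by blast
  qed
  ultimately show ?thesis
    using abs_velocity_less[OF assms(1)] by (auto simp: smooth_solution_def)
qed

text \<open>
  The solution is the inverse of the transit time, shifted by \<open>l\<close> so that it maps \<open>[a, b]\<close> onto
  \<open>[-l, l]\<close>.
\<close>

lemma exists_increasing_smooth_solution:
  assumes "\<epsilon> > 0" "l > 0" and f: "C2_on UNIV f" and "a < b"
    and pos: "\<And>u. u \<in> {a..b} \<Longrightarrow> f u + c > 0" and T: "transit_time \<epsilon> f a c b = 2 * l"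
  shows "\<exists>v. smooth_solution \<epsilon> l f a b v \<and> strict_mono_on {-l..l} v"
proof -
  define G where "G = (\<lambda>u. transit_time \<epsilon> f a c u - l)"
  have G: "(G has_real_derivative 1 / velocity \<epsilon> (f u + c)) (at u within {a..b})"
    if "u \<in> {a..b}" for u
    unfolding G_def using transit_time_has_derivative[OF assms(1) f pos that]
    by (auto intro!: derivative_eq_intros)
  have Ga: "G a = -l" "G b = l" using T by (simp_all add: G_def transit_time_def)
  have mono: "strict_mono_on {a..b} G"
    using transit_time_strict_mono[OF assms(1) f pos] by (auto simp: G_def strict_mono_on_def)
  have cG: "continuous_on {a..b} G" using G by (meson DERIV_continuous_on)
  have inj: "inj_on G {a..b}" using mono by (rule strict_mono_on_imp_inj_on)
  have im: "G ` {a..b} = {-l..l}"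
  proof
    show "G ` {a..b} \<subseteq> {-l..l}"
      using strict_mono_on_leD[OF mono] Ga assms(4) by fastforce
    show "{-l..l} \<subseteq> G ` {a..b}"
    proof
      fix y assume "y \<in> {-l..l}"
      then have "\<exists>x\<ge>a. x \<le> b \<and> G x = y"
        by (intro IVT') (use Ga cG assms(4) in auto)
      then show "y \<in> G ` {a..b}" by auto
    qed
  qed
  define v where "v = the_inv_into {a..b} G"
  have vG: "v (G u) = u" if "u \<in> {a..b}" for u
    unfolding v_def using the_inv_into_f_f[OF inj that] .
  have cv: "continuous_on {-l..l} v"
    using continuous_on_inv[OF cG _ , of v] vG im by auto
  have ode: "(v has_real_derivative velocity \<epsilon> (f (v x) + c)) (at x within {-l..l})"
    if "x \<in> {-l..l}" for x
  proof -
    have "x \<in> G ` {a..b}" using that im by simp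
    then obtain u where u: "u \<in> {a..b}" "x = G u" by blast
    have nz: "velocity \<epsilon> (f u + c) \<noteq> 0" using pos[OF u(1)] velocity_eq_0_iff[OF assms(1)] by force
    have "(v has_derivative (*) (velocity \<epsilon> (f u + c))) (at (G u) within G ` {a..b})"
    proof (rule has_derivative_inverse_within)
      show "(G has_derivative (*) (1 / velocity \<epsilon> (f u + c))) (at u within {a..b})"
        using G[OF u(1)] by (rule has_field_derivative_imp_has_derivative)
      show "continuous (at (G u) within G ` {a..b}) v"
        using cv that u(2) im by (simp add: continuous_on_eq_continuous_within)
      show "(*) (velocity \<epsilon> (f u + c)) \<circ> (*) (1 / velocity \<epsilon> (f u + c)) = id"
        using nz by (auto simp: fun_eq_iff)
    qed (use u vG in \<open>auto intro: linear_times\<close>)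
    then show ?thesis using u vG im by (simp add: has_field_derivative_def)
  qed
  have ends: "v (-l) = a" "v l = b" using vG[of a] vG[of b] Ga assms(4) by auto
  have "strict_mono_on {-l..l} v"
  proof (rule strict_mono_onI)
    fix r s assume rs: "r \<in> {-l..l}" "s \<in> {-l..l}" "r < s"
    then obtain x y where xy: "x \<in> {a..b}" "r = G x" "y \<in> {a..b}" "s = G y" using im by blast
    then have "x < y" using strict_mono_on_leD[OF mono, of y x] rs(3) by force
    then show "v r < v s" using xy vG by simp
  qed
  then show ?thesis using smooth_solution_of_ode[OF assms(1,2) f ode] ends by auto
qed

theorem proposition2p5:
  fixes \<epsilon> l u_minus u_plus :: real and f :: "real \<Rightarrow> real"
  assumes "l > 0" and "\<epsilon> > 0" and "C2_on UNIV f" and "u_plus > u_minus"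
  shows "(\<exists>v. smooth_solution \<epsilon> l f u_minus u_plus v \<and> strict_mono_on {-l..l} v \<and>
            (\<forall>w. smooth_solution \<epsilon> l f u_minus u_plus w \<and> strict_mono_on {-l..l} w \<longrightarrow>
                 (\<forall>x\<in>{-l..l}. w x = v x)))
         \<longleftrightarrow> 2 * l / \<epsilon> > u_plus - u_minus"
proof
  assume "u_plus - u_minus < 2 * l / \<epsilon>"
  then have "\<epsilon> * (u_plus - u_minus) < 2 * l"
    using assms(2) by (simp add: field_simps)
  then obtain c where "\<And>u. u \<in> {u_minus..u_plus} \<Longrightarrow> f u + c > 0"
    "transit_time \<epsilon> f u_minus c u_plus = 2 * l"
    using exists_constant_with_transit_time[OF assms(2-4)] by blast
  then obtain v where "smooth_solution \<epsilon> l f u_minus u_plus v" "strict_mono_on {-l..l} v"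
    using exists_increasing_smooth_solution[OF assms(2,1,3,4)] by blast
  then show "\<exists>v. smooth_solution \<epsilon> l f u_minus u_plus v \<and> strict_mono_on {-l..l} v \<and>
            (\<forall>w. smooth_solution \<epsilon> l f u_minus u_plus w \<and> strict_mono_on {-l..l} w \<longrightarrow>
                 (\<forall>x\<in>{-l..l}. w x = v x))"
    using smooth_solution_unique[OF assms(2,1,3,4)] by blast
qed (use gap_less_of_smooth_solution[OF assms(2,1)] in blast)

end
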